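(* Let $\mathscr{G} = (\mathscr{V}, \mathscr{E})$ be a finite simple undirected $D$-regular graph with $N$ vertices, let $p \in (0,1)$, and let $S$ be the size of the open cluster of a uniformly random vertex in bond percolation with parameter $p$ on $\mathscr{G}$. Then $$E(S) \leq N - (N-1)(1-p)^D$$ and $$E(S^2) \leq N^2 - (N-1)(2N-1)(1-p)^D + (N-1)(N-2)(1-p)^{2D-1}.$$
   Context: Bond percolation with parameter $p$ on a finite simple undirected graph $\mathscr{G}=(\mathscr{V},\mathscr{E})$: $(\zeta(e))_{e\in\mathscr{E}}$ are independent Bernoulli($p$) random variables; edge $e$ is open if $\zeta(e)=1$ and closed if $\zeta(e)=0$. For a vertex $x$, the open cluster $\mathscr{C}_x$ is the set of vertices $y\in\mathscr{V}$ such that there is a path of open edges connecting $x$ and $y$ (in particular $x\in\mathscr{C}_x$). The vertex $x$ is chosen uniformly at random in $\mathscr{V}$, independently of the $\zeta(e)$, and $S = \mathrm{card}(\mathscr{C}_x)$. *)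

theory Defs
  imports "HOL-Probability.Probability"
begin

definition simple_graph :: "'a set \<Rightarrow> 'a set set \<Rightarrow> bool" where
  "simple_graph V E \<longleftrightarrow> finite V \<and> (\<forall>e\<in>E. e \<subseteq> V \<and> card e = 2)"

definition regular_graph :: "'a set \<Rightarrow> 'a set set \<Rightarrow> nat \<Rightarrow> bool" where
  "regular_graph V E D \<longleftrightarrow> simple_graph V E \<and> (\<forall>v\<in>V. card {e \<in> E. v \<in> e} = D)"

text \<open>A configuration \<open>z\<close> is a Boolean function on edges, with True standing for the value 1
  (open). A one-element list is the trivial path, so a vertex belongs to its own cluster.\<close>

definition open_path :: "'a set \<Rightarrow> 'a set set \<Rightarrow> ('a set \<Rightarrow> bool) \<Rightarrow> 'a list \<Rightarrow> bool" where
  "open_path V E z xs \<longleftrightarrow>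
     xs \<noteq> [] \<and> distinct xs \<and> set xs \<subseteq> V \<and> successively (\<lambda>u v. {u, v} \<in> E \<and> z {u, v}) xs"

definition open_cluster :: "'a set \<Rightarrow> 'a set set \<Rightarrow> ('a set \<Rightarrow> bool) \<Rightarrow> 'a \<Rightarrow> 'a set" where
  "open_cluster V E z x = {y \<in> V. \<exists>xs. open_path V E z xs \<and> hd xs = x \<and> last xs = y}"

definition bond_percolation ::
    "'w measure \<Rightarrow> 'a set set \<Rightarrow> real \<Rightarrow> ('a set \<Rightarrow> 'w \<Rightarrow> bool) \<Rightarrow> bool" where
  "bond_percolation M E p \<zeta> \<longleftrightarrow>
     prob_space M \<and>
     prob_space.indep_vars M (\<lambda>_. count_space UNIV) \<zeta> E \<and>
     (\<forall>e\<in>E. distr M (count_space UNIV) (\<zeta> e) = measure_pmf (bernoulli_pmf p))"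

text \<open>The vertex \<open>X\<close> is independent of the whole family \<open>(\<zeta> e)\<close>, \<open>e \<in> E\<close>: the two generated
  sigma-algebras are independent (spelled out because \<open>indep_var\<close> requires equal value types).
  It lies in \<open>V\<close> almost surely rather than surely. Measurability of \<open>X\<close>, like that of each
  \<open>\<zeta> e\<close> above, is part of the independence condition.\<close>

definition independent_uniform_vertex ::
    "'w measure \<Rightarrow> 'a set \<Rightarrow> 'a set set \<Rightarrow> ('a set \<Rightarrow> 'w \<Rightarrow> bool) \<Rightarrow> ('w \<Rightarrow> 'a) \<Rightarrow> bool" where
  "independent_uniform_vertex M V E \<zeta> X \<longleftrightarrow>
     distr M (count_space UNIV) X = measure_pmf (pmf_of_set V) \<and>
     prob_space.indep_set M
       {X -` A \<inter> space M | A. A \<in> sets (count_space UNIV)}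
       {(\<lambda>\<omega>. \<lambda>e\<in>E. \<zeta> e \<omega>) -` B \<inter> space M | B. B \<in> sets (\<Pi>\<^sub>M e\<in>E. count_space UNIV)}"

definition cluster_size ::
    "'a set \<Rightarrow> 'a set set \<Rightarrow> ('a set \<Rightarrow> 'w \<Rightarrow> bool) \<Rightarrow> ('w \<Rightarrow> 'a) \<Rightarrow> 'w \<Rightarrow> nat" where
  "cluster_size V E \<zeta> X \<omega> = card (open_cluster V E (\<lambda>e. \<zeta> e \<omega>) (X \<omega>))"

end

theory Submission imports Defs begin

text \<open>
  A vertex lies in a cluster of more than one vertex only if one of its edges is open. Call a
  vertex isolated if all its edges are closed, and let \<open>I x\<close> be the indicator of this event;
  it has probability \<open>(1 - p) ^ D\<close>.

  The cluster of an isolated vertex is a singleton, and otherwise it has at most \<open>N\<close> vertices,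
  so its size is at most \<open>1 + (N - 1) * (1 - I x)\<close> (\<open>card_open_cluster_le\<close>). Taking expectations
  gives the first bound.

  For the second moment, write \<open>s\<^sup>2 = 1 + 3 * (s - 1) + (s - 1) * (s - 2)\<close>, where \<open>s\<close> is the size
  of the cluster of \<open>x\<close>. The linear term is handled as before. In the product, the factor \<open>s - 2\<close>
  is bounded by \<open>N - 2\<close>. For the factor \<open>s - 1\<close>, note that the whole cluster of a non-isolated
  vertex consists of non-isolated vertices, so that \<open>s - 1\<close> is at most the sum of \<open>1 - I y\<close> over
  all \<open>y\<close> other than \<open>x\<close>. The resulting pointwise bound (\<open>card_open_cluster_square_le\<close>) involves
  only \<open>I x\<close> and the products \<open>(1 - I x) * (1 - I y)\<close>.
  Since the graph is simple, two vertices share at most one edge,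
  hence together they meet at least \<open>2 * D - 1\<close> edges (\<open>card_incident_Un\<close>), and the product
  \<open>I x * I y\<close> has expectation at most \<open>(1 - p) powi (2 * D - 1)\<close>.

  Both pointwise bounds hold for every starting vertex and are linear combinations of indicators
  that certain sets of edges are entirely closed. Independence gives the expectation of each such
  indicator on the event that the random vertex is a given one
  (\<open>has_bochner_integral_vertex_all_closed\<close>), and summing over the vertices concludes the proof
  (\<open>integral_uniform_vertex_le\<close>).
\<close>

section \<open>Isolated vertices and clusters\<close>

definition incident :: "'a set set \<Rightarrow> 'a \<Rightarrow> 'a set set" where
  "incident E v = {e \<in> E. v \<in> e}"

text \<open>Real-valued, so that sums and products of these indicators can be integrated directly;
  on the edges at a vertex it is the indicator that the vertex is isolated.\<close>

definition all_closed :: "('a set \<Rightarrow> bool) \<Rightarrow> 'a set set \<Rightarrow> real" where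
  "all_closed z F = of_bool (\<forall>e\<in>F. \<not> z e)"

lemma all_closed_Un: "all_closed z (F \<union> G) = all_closed z F * all_closed z G"
  by (auto simp: all_closed_def)

text \<open>Inclusion-exclusion: the only edge that can contain both vertices is the one joining them.
  The \<open>+ 1\<close> on the right stands for subtracting 1 on the left, which would be truncated at
  \<open>D = 0\<close>.\<close>

lemma card_incident_Un:
  assumes G: "regular_graph V E D" and x: "x \<in> V" and y: "y \<in> V" and "x \<noteq> y"
  shows "2 * D \<le> card (incident E x \<union> incident E y) + 1"
proof -
  have sg: "finite V" "\<And>e. e \<in> E \<Longrightarrow> e \<subseteq> V \<and> card e = 2"
    using G by (auto simp: regular_graph_def simple_graph_def)
  have "finite E"
    using sg by (meson Pow_iff finite_Pow_iff rev_finite_subset subsetI)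
  then have fin: "finite (incident E x)" "finite (incident E y)"
    by (auto simp: incident_def)
  have "e = {x, y}" if "e \<in> incident E x \<inter> incident E y" for e
  proof -
    have "{x, y} \<subseteq> e" "e \<subseteq> V" "card e = 2"
      using that sg by (auto simp: incident_def)
    moreover from this have "finite e"
      using sg(1) finite_subset by blast
    ultimately show ?thesis
      using card_subset_eq[of e "{x, y}"] \<open>x \<noteq> y\<close> by simp
  qed
  then have "incident E x \<inter> incident E y \<subseteq> {{x, y}}"
    by blast
  then have "card (incident E x \<inter> incident E y) \<le> 1"
    using card_mono[of "{{x, y}}"] by simp
  moreover have "card (incident E x) = D" "card (incident E y) = D"
    using G x y by (auto simp: regular_graph_def incident_def)
  ultimately show ?thesis
    using card_Un_Int[OF fin] by linarith
qed

lemma self_in_open_cluster: "x \<in> V \<Longrightarrow> x \<in> open_cluster V E z x"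
  by (auto simp: open_cluster_def open_path_def intro!: exI[of _ "[x]"])

text \<open>The first and the last edge of an open path between distinct vertices are open and
  incident to its ends.\<close>

lemma open_cluster_ends_open:
  assumes y: "y \<in> open_cluster V E z x" and "y \<noteq> x"
  shows "(\<exists>e\<in>incident E x. z e) \<and> (\<exists>e\<in>incident E y. z e)"
proof -
  obtain xs where xs: "xs \<noteq> []" "successively (\<lambda>u v. {u, v} \<in> E \<and> z {u, v}) xs"
      "hd xs = x" "last xs = y"
    using y by (auto simp: open_cluster_def open_path_def)
  from xs obtain u us where first: "xs = x # u # us"
    using \<open>y \<noteq> x\<close> by (metis last.simps list.exhaust_sel)
  have "butlast xs \<noteq> []"
    using first by simp
  then obtain w ws where "butlast xs = ws @ [w]"
    using rev_exhaust by blast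
  then have last: "xs = ws @ [w, y]"
    using append_butlast_last_id[OF xs(1)] xs(4) by simp
  have "{x, u} \<in> E \<and> z {x, u}"
    using xs(2) unfolding first by simp
  moreover have "{w, y} \<in> E \<and> z {w, y}"
    using xs(2) unfolding last by (simp add: successively_append_iff)
  ultimately show ?thesis
    by (auto simp: incident_def)
qed

lemma open_cluster_isolated:
  assumes "x \<in> V" and "all_closed z (incident E x) = 1"
  shows "open_cluster V E z x = {x}"
  using self_in_open_cluster[OF assms(1)] open_cluster_ends_open[of _ V E z x] assms(2)
  by (auto simp: all_closed_def)

lemma card_open_cluster_bounds:
  assumes fin: "finite V" and x: "x \<in> V"
  shows "card (open_cluster V E z x) \<ge> 1" and "card (open_cluster V E z x) \<le> card V"
proof -
  have sub: "open_cluster V E z x \<subseteq> V"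
    by (auto simp: open_cluster_def)
  then show "card (open_cluster V E z x) \<le> card V"
    using fin card_mono by blast
  show "card (open_cluster V E z x) \<ge> 1"
    using self_in_open_cluster[OF x] finite_subset[OF sub fin]
    by (metis One_nat_def Suc_leI card_gt_0_iff empty_iff)
qed

lemma card_open_cluster_le:
  assumes fin: "finite V" and x: "x \<in> V"
  shows "real (card (open_cluster V E z x))
    \<le> 1 + (real (card V) - 1) * (1 - all_closed z (incident E x))"
proof (cases "all_closed z (incident E x) = 1")
  case True
  then show ?thesis using open_cluster_isolated[OF x] by simp
next
  case False
  then have "all_closed z (incident E x) = 0"
    by (simp add: all_closed_def split: if_splits)
  then show ?thesis using card_open_cluster_bounds[OF fin x] by simp
qed

text \<open>Each summand is \<open>(1 - I x) * (1 - I y)\<close>, where \<open>I\<close> is the indicator of an isolated vertex;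
  it is expanded so that the bound is linear in the indicators to be integrated. If \<open>x\<close> is isolated,
  the summands vanish and both sides equal 1. Otherwise the sum counts the non-isolated vertices
  other than \<open>x\<close>, among which are all other vertices of the cluster.\<close>

lemma card_open_cluster_square_le:
  assumes fin: "finite V" and x: "x \<in> V"
  shows "(real (card (open_cluster V E z x)))\<^sup>2
    \<le> 1 + 3 * (real (card V) - 1) * (1 - all_closed z (incident E x))
        + (real (card V) - 2) * (\<Sum>y\<in>V - {x}. 1 - all_closed z (incident E x)
            - all_closed z (incident E y) + all_closed z (incident E x \<union> incident E y))"
proof (cases "all_closed z (incident E x) = 1")
  case True
  then show ?thesis using open_cluster_isolated[OF x True] by (simp add: all_closed_Un)
next
  case False
  then have ix: "all_closed z (incident E x) = 0"
    by (simp add: all_closed_def split: if_splits)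
  define C where "C = open_cluster V E z x"
  have C: "C \<subseteq> V" "x \<in> C"
    using self_in_open_cluster[OF x] by (auto simp: C_def open_cluster_def)
  have finC: "finite C"
    using C(1) fin finite_subset by blast
  have one: "all_closed z (incident E y) = 0" if "y \<in> C - {x}" for y
    using open_cluster_ends_open[of y V E z x] that by (auto simp: C_def all_closed_def)
  define W where "W = (\<Sum>y\<in>V - {x}. 1 - all_closed z (incident E y))"
  have "real (card C) - 1 = (\<Sum>y\<in>C - {x}. 1 - all_closed z (incident E y))"
    using C finC card_Suc_Diff1[OF finC C(2)] by (simp add: one)
  also have "\<dots> \<le> W"
    unfolding W_def using fin C by (intro sum_mono2) (auto simp: all_closed_def)
  finally have CW: "real (card C) - 1 \<le> W" .
  have "1 \<le> card C" "card C \<le> card V"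
    using card_open_cluster_bounds[OF fin x] by (auto simp: C_def)
  have "(real (card C))\<^sup>2 = 1 + 3 * (real (card C) - 1)
      + (real (card C) - 1) * (real (card C) - 2)"
    by (simp add: power2_eq_square algebra_simps)
  also have "\<dots> \<le> 1 + 3 * (real (card V) - 1) + (real (card V) - 2) * W"
    \<comment> \<open>The product of \<open>card C - 1\<close> and \<open>card C - 2\<close> can be bounded factor by factor only if the
      latter is nonnegative, hence the separate case.\<close>
  proof (cases "card C = 1")
    case True
    have "card V \<noteq> 1 \<or> W = 0"
      using x by (auto simp: W_def card_1_singleton_iff)
    then have "0 \<le> (real (card V) - 2) * W"
      using True CW \<open>card C \<le> card V\<close> by (cases "card V = 1") auto
    then show ?thesis
      using True \<open>card C \<le> card V\<close> by simp
  next
    case False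
    then have "2 \<le> card C" using \<open>1 \<le> card C\<close> by simp
    then have "(real (card C) - 1) * (real (card C) - 2) \<le> W * (real (card V) - 2)"
      using CW \<open>card C \<le> card V\<close> by (intro mult_mono) auto
    then show ?thesis
      using \<open>card C \<le> card V\<close> by (simp add: mult.commute)
  qed
  finally show ?thesis
    by (simp add: ix all_closed_Un W_def C_def)
qed

section \<open>Expectations over the configuration and the random vertex\<close>

lemma prob_all_closed:
  assumes perc: "bond_percolation M E p \<zeta>" and p: "0 \<le> p" "p \<le> 1"
    and F: "F \<subseteq> E" "finite F"
  shows "measure M {\<omega> \<in> space M. \<forall>e\<in>F. \<not> \<zeta> e \<omega>} = (1 - p) ^ card F"
proof -
  interpret prob_space M
    using perc by (simp add: bond_percolation_def)
  have ind: "indep_vars (\<lambda>_. count_space UNIV) \<zeta> E"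
    and dist: "\<And>e. e \<in> E \<Longrightarrow> distr M (count_space UNIV) (\<zeta> e) = measure_pmf (bernoulli_pmf p)"
    using perc by (auto simp: bond_percolation_def)
  have closed: "prob (\<zeta> e -` {False} \<inter> space M) = 1 - p" if "e \<in> E" for e
  proof -
    have "\<zeta> e \<in> measurable M (count_space UNIV)"
      using ind that by (simp add: indep_vars_def)
    then have "prob (\<zeta> e -` {False} \<inter> space M)
        = measure (distr M (count_space UNIV) (\<zeta> e)) {False}"
      by (simp add: measure_distr)
    then show ?thesis
      using p by (simp add: dist[OF that] measure_pmf_single)
  qed
  show ?thesis
  proof (cases "F = {}")
    case True
    then show ?thesis by (simp add: prob_space)
  next
    case False
    have "{\<omega> \<in> space M. \<forall>e\<in>F. \<not> \<zeta> e \<omega>} = (\<Inter>e\<in>F. \<zeta> e -` {False} \<inter> space M)"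
      using False by auto
    also have "prob \<dots> = (\<Prod>e\<in>F. prob (\<zeta> e -` {False} \<inter> space M))"
      using F False by (intro indep_varsD[OF ind]) auto
    also have "\<dots> = (1 - p) ^ card F"
      using F(1) closed by (simp add: subset_iff)
    finally show ?thesis .
  qed
qed

lemma measurable_uniform_vertex:
  assumes perc: "bond_percolation M E p \<zeta>"
    and unif: "independent_uniform_vertex M V E \<zeta> X"
  shows "X \<in> measurable M (count_space UNIV)"
proof -
  interpret prob_space M
    using perc by (simp add: bond_percolation_def)
  have "{X -` A \<inter> space M | A. A \<in> sets (count_space UNIV)} \<subseteq> events"
    using unif by (auto simp: independent_uniform_vertex_def indep_set_def indep_sets_def
        split: bool.splits)
  then show ?thesis
    by (auto intro!: measurableI)
qed

text \<open>The random vertex is independent of the configuration, so the probability that it equals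
  \<open>v\<close> while the edges in \<open>F\<close> are closed factorises. Restricting to \<open>X \<omega> = v\<close> takes the place of
  conditioning on the random vertex.\<close>

lemma has_bochner_integral_vertex_all_closed:
  assumes perc: "bond_percolation M E p \<zeta>" and p: "0 \<le> p" "p \<le> 1"
    and unif: "independent_uniform_vertex M V E \<zeta> X"
    and V: "finite V" "v \<in> V" and E: "finite E" and F: "F \<subseteq> E"
  shows "has_bochner_integral M (\<lambda>\<omega>. of_bool (X \<omega> = v) * all_closed (\<lambda>e. \<zeta> e \<omega>) F)
    ((1 - p) ^ card F / real (card V))"
proof -
  interpret prob_space M
    using perc by (simp add: bond_percolation_def)
  let ?AX = "{X -` A \<inter> space M | A. A \<in> sets (count_space UNIV)}"
  let ?AZ = "{(\<lambda>\<omega>. \<lambda>e\<in>E. \<zeta> e \<omega>) -` B \<inter> space M | B.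
    B \<in> sets (\<Pi>\<^sub>M e\<in>E. count_space UNIV)}"
  have ind: "indep_set ?AX ?AZ"
    and dist: "distr M (count_space UNIV) X = measure_pmf (pmf_of_set V)"
    using unif by (auto simp: independent_uniform_vertex_def)
  have ev: "?AX \<subseteq> events" "?AZ \<subseteq> events"
    using ind by (auto simp: indep_set_def indep_sets_def split: bool.splits)
  note X = measurable_uniform_vertex[OF perc unif]
  let ?a = "X -` {v} \<inter> space M"
  let ?b = "{\<omega> \<in> space M. \<forall>e\<in>F. \<not> \<zeta> e \<omega>}"
  have a: "?a \<in> ?AX"
    by auto
  have b: "?b \<in> ?AZ"
  proof -
    \<comment> \<open>The edges of \<open>F\<close> being closed is a cylinder event of the configuration.\<close>
    let ?B = "\<Pi>\<^sub>E e\<in>E. (if e \<in> F then {False} else UNIV)"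
    have "?B \<in> sets (\<Pi>\<^sub>M e\<in>E. count_space UNIV)"
      using E by (intro sets_PiM_I_finite) auto
    moreover have "?b = (\<lambda>\<omega>. \<lambda>e\<in>E. \<zeta> e \<omega>) -` ?B \<inter> space M"
      using F by (auto simp: PiE_iff split: if_splits)
    ultimately show ?thesis
      by blast
  qed
  have nonempty: "V \<noteq> {}"
    using V(2) by blast
  have "prob ?a = measure (distr M (count_space UNIV) X) {v}"
    using X by (simp add: measure_distr)
  also have "\<dots> = 1 / real (card V)"
    unfolding dist measure_pmf_single pmf_of_set[OF nonempty V(1)] by (simp add: V(2))
  finally have pa: "prob ?a = 1 / real (card V)" .
  have "prob (?a \<inter> ?b) = prob ?a * prob ?b"
    by (rule indep_setD[OF ind a b])
  also have "\<dots> = (1 - p) ^ card F / real (card V)"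
    using prob_all_closed[OF perc p F finite_subset[OF F E]] pa by simp
  finally have pab: "prob (?a \<inter> ?b) = (1 - p) ^ card F / real (card V)" .
  have "?a \<inter> ?b \<in> events"
    by (intro sets.Int subsetD[OF ev(1) a] subsetD[OF ev(2) b])
  then have "has_bochner_integral M (indicator (?a \<inter> ?b)) (prob (?a \<inter> ?b))"
    by (rule has_bochner_integral_real_indicator) (simp add: emeasure_eq_measure)
  then show ?thesis
    unfolding pab
    by (rule iffD1[OF has_bochner_integral_cong[OF refl _ refl], rotated])
      (simp add: all_closed_def indicator_def)
qed

lemma AE_uniform_vertex_in:
  assumes perc: "bond_percolation M E p \<zeta>"
    and unif: "independent_uniform_vertex M V E \<zeta> X" and V: "finite V" "V \<noteq> {}"
  shows "AE \<omega> in M. X \<omega> \<in> V"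
proof -
  interpret prob_space M
    using perc by (simp add: bond_percolation_def)
  have dist: "distr M (count_space UNIV) X = measure_pmf (pmf_of_set V)"
    using unif by (simp add: independent_uniform_vertex_def)
  note X = measurable_uniform_vertex[OF perc unif]
  have "AE v in distr M (count_space UNIV) X. v \<in> V"
    unfolding dist using V by (simp add: AE_measure_pmf_iff)
  then show ?thesis
    by (rule AE_distrD[OF X])
qed

text \<open>Splitting an expectation according to the value of the random vertex. Nonnegativity
  of \<open>f\<close> takes the place of integrability: the integral of a function that is not integrable is 0,
  and the dominating function is nonnegative almost everywhere.\<close>

lemma integral_uniform_vertex_le:
  fixes f :: "'w \<Rightarrow> real"
  assumes AE: "AE \<omega> in M. X \<omega> \<in> V" and V: "finite V" "V \<noteq> {}"
    and nonneg: "\<And>\<omega>. 0 \<le> f \<omega>"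
    and le: "\<And>v \<omega>. v \<in> V \<Longrightarrow> X \<omega> = v \<Longrightarrow> f \<omega> \<le> g v \<omega>"
    and int: "\<And>v. v \<in> V \<Longrightarrow> has_bochner_integral M (\<lambda>\<omega>. of_bool (X \<omega> = v) * g v \<omega>) (I v)"
    and I: "\<And>v. v \<in> V \<Longrightarrow> I v \<le> b / real (card V)"
  shows "(\<integral>\<omega>. f \<omega> \<partial>M) \<le> b"
proof -
  let ?h = "\<lambda>\<omega>. \<Sum>v\<in>V. of_bool (X \<omega> = v) * g v \<omega>"
  have h: "has_bochner_integral M ?h (\<Sum>v\<in>V. I v)"
    by (intro has_bochner_integral_sum int)
  have "f \<omega> \<le> ?h \<omega>" if "X \<omega> \<in> V" for \<omega>
  proof -
    have "?h \<omega> = g (X \<omega>) \<omega>"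
      using V that by (simp add: of_bool_def if_distrib[of "\<lambda>x. x * _"] sum.delta cong: if_cong)
    then show ?thesis
      using le[OF that refl] by simp
  qed
  then have above: "f \<omega> \<le> ?h \<omega> \<and> 0 \<le> ?h \<omega>" if "X \<omega> \<in> V" for \<omega>
    using order_trans[OF nonneg[of \<omega>]] that by blast
  have "(\<integral>\<omega>. f \<omega> \<partial>M) \<le> (\<integral>\<omega>. ?h \<omega> \<partial>M)"
  proof (rule integral_mono_AE')
    show "integrable M ?h"
      using h by (simp add: has_bochner_integral_iff)
    show "AE \<omega> in M. f \<omega> \<le> ?h \<omega>" "AE \<omega> in M. 0 \<le> ?h \<omega>"
      using above by (auto intro: eventually_mono[OF AE])
  qed
  also have "\<dots> = (\<Sum>v\<in>V. I v)"
    by (rule has_bochner_integral_integral_eq[OF h])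
  also have "\<dots> \<le> (\<Sum>v\<in>V. b / real (card V))"
    by (intro sum_mono I)
  also have "\<dots> = b"
    using V by simp
  finally show ?thesis .
qed

section \<open>Moments of the cluster size\<close>

theorem theorem2:
  fixes M :: "'w measure" and V :: "'a set" and E :: "'a set set"
    and D N :: nat and p :: real
    and \<zeta> :: "'a set \<Rightarrow> 'w \<Rightarrow> bool" and X :: "'w \<Rightarrow> 'a" and S :: "'w \<Rightarrow> nat"
  assumes "regular_graph V E D" and "V \<noteq> {}" and "card V = N"
    and "0 < p" and "p < 1"
    and "bond_percolation M E p \<zeta>"
    and "independent_uniform_vertex M V E \<zeta> X"
    and "S = cluster_size V E \<zeta> X"
  shows "(\<integral>\<omega>. real (S \<omega>) \<partial>M) \<le> real N - (real N - 1) * (1 - p) ^ D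
    \<and> (\<integral>\<omega>. (real (S \<omega>))\<^sup>2 \<partial>M) \<le>
        (real N)\<^sup>2 - (real N - 1) * (2 * real N - 1) * (1 - p) ^ D
          + (real N - 1) * (real N - 2) * (1 - p) powi (2 * int D - 1)"
proof -
  have V: "finite V" "V \<noteq> {}"
    using assms(1,2) by (auto simp: regular_graph_def simple_graph_def)
  have "E \<subseteq> Pow V"
    using assms(1) by (auto simp: regular_graph_def simple_graph_def)
  then have E: "finite E"
    using V(1) finite_subset by blast
  have degree: "card (incident E v) = D" if "v \<in> V" for v
    using assms(1) that by (auto simp: regular_graph_def incident_def)
  have inc: "incident E v \<subseteq> E" for v
    by (auto simp: incident_def)
  have "N \<ge> 1"
    using V assms(3) by (metis One_nat_def Suc_leI card_gt_0_iff)
  define q where "q = (1 - p) ^ D"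
  define r where "r = (1 - p) powi (2 * int D - 1)"
  let ?c = "\<lambda>F \<omega>. all_closed (\<lambda>e. \<zeta> e \<omega>) F"
  let ?i = "incident E"
  note AE = AE_uniform_vertex_in[OF assms(6,7) V]
  note closed = has_bochner_integral_vertex_all_closed[OF assms(6) less_imp_le[OF assms(4)]
      less_imp_le[OF assms(5)] assms(7) V(1) _ E, unfolded assms(3)]
  have const: "has_bochner_integral M (\<lambda>\<omega>. of_bool (X \<omega> = v)) (1 / real N)" if "v \<in> V" for v
    using closed[OF that, of "{}"] by (simp add: all_closed_def)
  have single: "has_bochner_integral M (\<lambda>\<omega>. of_bool (X \<omega> = v) * ?c (?i y) \<omega>) (q / real N)"
    if "v \<in> V" "y \<in> V" for v y
    using closed[OF that(1) inc[of y]] degree[OF that(2)] by (simp add: q_def)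
  have pair: "has_bochner_integral M (\<lambda>\<omega>. of_bool (X \<omega> = v) * ?c (?i v \<union> ?i y) \<omega>)
      ((1 - p) ^ card (?i v \<union> ?i y) / real N)" if "v \<in> V" for v y
    using closed[OF that, of "?i v \<union> ?i y"] inc by blast
  have overlap: "(1 - p) ^ card (?i v \<union> ?i y) \<le> r" if "v \<in> V" "y \<in> V" "v \<noteq> y" for v y
  proof -
    \<comment> \<open>Integer exponents also cover \<open>D = 0\<close>, where the right-hand exponent is \<open>- 1\<close>.\<close>
    have "(1 - p) powi int (card (?i v \<union> ?i y)) \<le> (1 - p) powi (2 * int D - 1)"
      using card_incident_Un[OF assms(1) that] assms(4,5)
      by (intro power_int_decreasing) auto
    then show ?thesis
      by (simp add: r_def)
  qed

  have first: "(\<integral>\<omega>. real (S \<omega>) \<partial>M) \<le> real N - (real N - 1) * q"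
  proof (rule integral_uniform_vertex_le[OF AE V])
    fix v assume v: "v \<in> V"
    have "has_bochner_integral M
        (\<lambda>\<omega>. real N * of_bool (X \<omega> = v) - (real N - 1) * (of_bool (X \<omega> = v) * ?c (?i v) \<omega>))
        (real N * (1 / real N) - (real N - 1) * (q / real N))"
      using const[OF v] single[OF v v]
      by (intro has_bochner_integral_diff has_bochner_integral_mult_right) auto
    then show "has_bochner_integral M
        (\<lambda>\<omega>. of_bool (X \<omega> = v) * (1 + (real N - 1) * (1 - ?c (?i v) \<omega>)))
        (real N * (1 / real N) - (real N - 1) * (q / real N))"
      by (simp add: algebra_simps)
    show "real N * (1 / real N) - (real N - 1) * (q / real N)
        \<le> (real N - (real N - 1) * q) / real (card V)"
      using assms(3) by (simp add: diff_divide_distrib)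
  next
    fix v \<omega> assume "v \<in> V" "X \<omega> = v"
    then show "real (S \<omega>) \<le> 1 + (real N - 1) * (1 - ?c (?i v) \<omega>)"
      using card_open_cluster_le[OF V(1)] by (simp add: assms(8) cluster_size_def assms(3)[symmetric])
  qed simp

  let ?b = "(real N)\<^sup>2 - (real N - 1) * (2 * real N - 1) * q
    + (real N - 1) * (real N - 2) * r"
  have second: "(\<integral>\<omega>. (real (S \<omega>))\<^sup>2 \<partial>M) \<le> ?b"
  proof (rule integral_uniform_vertex_le[OF AE V])
    fix v assume v: "v \<in> V"
    let ?u = "\<lambda>\<omega>. of_bool (X \<omega> = v) :: real"
    let ?I = "1 / real N + 3 * (real N - 1) * (1 / real N - q / real N)
      + (real N - 2) * (\<Sum>y\<in>V - {v}. 1 / real N - q / real N - q / real N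
          + (1 - p) ^ card (?i v \<union> ?i y) / real N)"
    have "has_bochner_integral M
        (\<lambda>\<omega>. ?u \<omega> + 3 * (real N - 1) * (?u \<omega> - ?u \<omega> * ?c (?i v) \<omega>)
          + (real N - 2) * (\<Sum>y\<in>V - {v}. ?u \<omega> - ?u \<omega> * ?c (?i v) \<omega>
            - ?u \<omega> * ?c (?i y) \<omega> + ?u \<omega> * ?c (?i v \<union> ?i y) \<omega>)) ?I"
      by (intro has_bochner_integral_add has_bochner_integral_diff has_bochner_integral_sum
          has_bochner_integral_mult_right const single pair v) auto
    then show "has_bochner_integral M
        (\<lambda>\<omega>. ?u \<omega> * (1 + 3 * (real N - 1) * (1 - ?c (?i v) \<omega>)
          + (real N - 2) * (\<Sum>y\<in>V - {v}. 1 - ?c (?i v) \<omega>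
            - ?c (?i y) \<omega> + ?c (?i v \<union> ?i y) \<omega>))) ?I"
      by (rule back_subst[where P = "\<lambda>h. has_bochner_integral M h ?I"])
        (auto simp: fun_eq_iff)
    have cardV: "real (card (V - {v})) = real N - 1"
      using v V assms(3) \<open>N \<ge> 1\<close> by (simp add: of_nat_diff)
    have "(\<Sum>y\<in>V - {v}. 1 / real N - q / real N - q / real N
          + (1 - p) ^ card (?i v \<union> ?i y) / real N)
        \<le> (\<Sum>y\<in>V - {v}. (1 - 2 * q + r) / real N)"
    proof (intro sum_mono)
      fix y assume "y \<in> V - {v}"
      then have "(1 - p) ^ card (?i v \<union> ?i y) / real N \<le> r / real N"
        using overlap[OF v, of y] by (intro divide_right_mono) auto
      then show "1 / real N - q / real N - q / real N
          + (1 - p) ^ card (?i v \<union> ?i y) / real N \<le> (1 - 2 * q + r) / real N"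
        by (simp add: add_divide_distrib diff_divide_distrib)
    qed
    also have "\<dots> = (real N - 1) * ((1 - 2 * q + r) / real N)"
      by (simp add: cardV)
    finally have sum: "(\<Sum>y\<in>V - {v}. 1 / real N - q / real N - q / real N
          + (1 - p) ^ card (?i v \<union> ?i y) / real N) \<le> (real N - 1) * ((1 - 2 * q + r) / real N)" .
    have "(real N - 2) * (\<Sum>y\<in>V - {v}. 1 / real N - q / real N - q / real N
          + (1 - p) ^ card (?i v \<union> ?i y) / real N)
        \<le> (real N - 2) * ((real N - 1) * ((1 - 2 * q + r) / real N))"
      \<comment> \<open>For \<open>N = 1\<close> the factor \<open>N - 2\<close> is negative, but the sum is empty.\<close>
    proof (cases "N = 1")
      case True
      then have "V - {v} = {}"
        using cardV V by simp
      then show ?thesis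
        by (simp only: sum.empty) (simp add: True)
    next
      case False
      then show ?thesis
        using sum \<open>N \<ge> 1\<close> by (intro mult_left_mono) auto
    qed
    then have "?I \<le> 1 / real N + 3 * (real N - 1) * (1 / real N - q / real N)
        + (real N - 2) * ((real N - 1) * ((1 - 2 * q + r) / real N))"
      by simp
    also have "\<dots> = ?b / real N"
      using \<open>N \<ge> 1\<close> by (simp add: field_simps power2_eq_square)
    finally show "?I \<le> ?b / real (card V)"
      by (simp add: assms(3))
  next
    fix v \<omega> assume "v \<in> V" "X \<omega> = v"
    then show "(real (S \<omega>))\<^sup>2 \<le> 1 + 3 * (real N - 1) * (1 - ?c (?i v) \<omega>)
          + (real N - 2) * (\<Sum>y\<in>V - {v}. 1 - ?c (?i v) \<omega>
            - ?c (?i y) \<omega> + ?c (?i v \<union> ?i y) \<omega>)"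
      using card_open_cluster_square_le[OF V(1)]
      by (simp add: assms(8) cluster_size_def assms(3)[symmetric])
  qed simp
  show ?thesis
    using first second by (simp add: q_def r_def)
qed

end
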